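(* Let $\Gamma$ be a discrete group and let $\Phi=(\Phi_t)_{t\ge0}$ be the quantum Markov semi-group on $\mathcal{L}(\Gamma)$ associated to a proper symmetric function $\psi:\Gamma\to\mathbb{Z}$ that is conditionally of negative type. If $\Phi$ is gradient-$\mathcal{S}_p$ for some $p\in[1,\infty]$, then for every $u,v\in\Gamma$ the function $\gamma^\psi_{u,v}:\Gamma\to\mathbb{Z}$ has compact (i.e. finite) support. In particular, $\Psi^{\lambda_u,\lambda_v}$ is of finite rank for all $u,v\in\Gamma$, and $\Phi$ is gradient-$\mathcal{S}_p$ for all $p\in[1,\infty]$.
   Context: $\mathbb{C}[\Gamma]=\mathrm{span}\{\lambda_g:g\in\Gamma\}$, where $\lambda$ is the left regular representation on $\ell_2(\Gamma)$, and $\mathcal{L}(\Gamma)$ is its strong closure. $\psi$ is proper if preimages of compact sets are finite; symmetric means $\psi(s)=\psi(s^{-1})$; conditionally of negative type means $\psi(e)=0$, $\psi(s)=\psi(s^{-1})$ and $\sum_{i,j}c_ic_j\psi(s_j^{-1}s_i)\le0$ for all $s_1,\dots,s_n\in\Gamma$ and real $c_i$ with $\sum_ic_i=0$. The semi-group associated with $\psi$ is $\Phi_t(\lambda_g)=e^{-t\psi(g)}\lambda_g$, a semi-group of normal unital completely positive trace preserving maps on $\mathcal{L}(\Gamma)$. Put $\Delta_\psi(\lambda_g)=\psi(g)\lambda_g$ on $\mathbb{C}[\Gamma]$, and for $a,b\in\mathbb{C}[\Gamma]$ put $\Psi^{a,b}(x)=\Delta_\psi(axb)+a\Delta_\psi(x)b-\Delta_\psi(ax)b-a\Delta_\psi(xb)$,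 $x\in\mathbb{C}[\Gamma]$. $\Phi$ is gradient-$\mathcal{S}_p$ if for all $a,b\in\mathbb{C}[\Gamma]$ the map $\Psi^{a,b}$ extends (via $x\mapsto x\delta_e$) to a bounded operator on $\ell_2(\Gamma)$ in the Schatten class $\mathcal{S}_p$ ($\mathcal{S}_\infty$ = compact operators). Finally $\gamma^\psi_{u,w}(v)=\psi(uvw)+\psi(v)-\psi(uv)-\psi(vw)$. *)

theory Defs
  imports "HOL-Analysis.Analysis"
begin

text \<open>
  The discrete group is the type \<open>'g\<close> of class \<open>group_add\<close>, whose operation is
  \<^emph>\<open>not\<close> assumed commutative; additive notation is the one the library's group class comes with.
  Thus \<open>e\<close> is \<open>0\<close>, \<open>s\<inverse>\<close> is \<open>- s\<close>, and \<open>uvw\<close> is \<open>u + v + w\<close>.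
\<close>

typedef 'g ell2 = "{f :: 'g \<Rightarrow> complex. (\<lambda>g. (cmod (f g))\<^sup>2) summable_on UNIV}"
  morphisms ell2_apply Abs_ell2
  by (rule exI[of _ "\<lambda>_. 0"]) simp

setup_lifting type_definition_ell2

lemma ell2_eqI: "(\<And>g. ell2_apply x g = ell2_apply y g) \<Longrightarrow> x = y"
  by (metis ell2_apply_inject ext)

lemma ell2_summable: "(\<lambda>g. (cmod (ell2_apply x g))\<^sup>2) summable_on UNIV"
  using ell2_apply[of x] by simp

lemma cmod_add_sq_le: "(cmod (a + b))\<^sup>2 \<le> 2 * (cmod a)\<^sup>2 + 2 * (cmod b)\<^sup>2"
proof -
  have "(cmod (a + b))\<^sup>2 \<le> (cmod a + cmod b)\<^sup>2"
    by (simp add: power_mono norm_triangle_ineq)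
  also have "\<dots> \<le> 2 * (cmod a)\<^sup>2 + 2 * (cmod b)\<^sup>2"
    using sum_squares_bound[of "cmod a" "cmod b"] by (simp add: power2_sum)
  finally show ?thesis .
qed

lemma ell2_add_summable:
  assumes "(\<lambda>g. (cmod (f g))\<^sup>2) summable_on UNIV" "(\<lambda>g. (cmod (h g))\<^sup>2) summable_on UNIV"
  shows "(\<lambda>g. (cmod (f g + h g))\<^sup>2) summable_on UNIV"
proof (rule summable_on_comparison_test)
  show "(\<lambda>g. 2 * (cmod (f g))\<^sup>2 + 2 * (cmod (h g))\<^sup>2) summable_on UNIV"
    by (intro summable_on_add summable_on_cmult_right assms)
qed (auto simp: cmod_add_sq_le)

lemma ell2_scale_summable:
  assumes "(\<lambda>g. (cmod (f g))\<^sup>2) summable_on UNIV"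
  shows "(\<lambda>g. (cmod (c * f g))\<^sup>2) summable_on UNIV"
  using summable_on_cmult_right[OF assms, of "(cmod c)\<^sup>2"]
  by (simp add: norm_mult power_mult_distrib)

lemma ell2_mult_summable:
  assumes "(\<lambda>g. (cmod (f g))\<^sup>2) summable_on UNIV" "(\<lambda>g. (cmod (h g))\<^sup>2) summable_on UNIV"
  shows "(\<lambda>g. f g * cnj (h g)) summable_on UNIV"
proof (rule Infinite_Sum.abs_summable_summable, rule Infinite_Sum.abs_summable_on_comparison_test')
  show "(\<lambda>g. (cmod (f g))\<^sup>2 + (cmod (h g))\<^sup>2) summable_on UNIV"
    by (intro summable_on_add assms)
  fix g
  have "0 \<le> cmod (f g) * cmod (h g)" by simp
  then have "cmod (f g) * cmod (h g) \<le> (cmod (f g))\<^sup>2 + (cmod (h g))\<^sup>2"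
    using sum_squares_bound[of "cmod (f g)" "cmod (h g)"] by linarith
  then show "cmod (f g * cnj (h g)) \<le> (cmod (f g))\<^sup>2 + (cmod (h g))\<^sup>2"
    by (simp add: norm_mult)
qed

text \<open>Linear in the first argument.\<close>

definition cinner :: "'g ell2 \<Rightarrow> 'g ell2 \<Rightarrow> complex" where
  "cinner x y = (\<Sum>\<^sub>\<infinity>g. ell2_apply x g * cnj (ell2_apply y g))"

lift_definition cscale :: "complex \<Rightarrow> 'g ell2 \<Rightarrow> 'g ell2" (infixr \<open>*\<^sub>C\<close> 75)
  is "\<lambda>c f g. c * f g" by (rule ell2_scale_summable)

text \<open>
  The library has no class of complex inner product spaces; topology and boundedness come from
  the underlying real one. It has the same norm.
\<close>

instantiation ell2 :: (type) real_inner
begin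

lift_definition zero_ell2 :: "'a ell2" is "\<lambda>_. 0" by simp

lift_definition plus_ell2 :: "'a ell2 \<Rightarrow> 'a ell2 \<Rightarrow> 'a ell2" is "\<lambda>f h g. f g + h g"
  by (rule ell2_add_summable)

lift_definition uminus_ell2 :: "'a ell2 \<Rightarrow> 'a ell2" is "\<lambda>f g. - f g" by simp

lift_definition minus_ell2 :: "'a ell2 \<Rightarrow> 'a ell2 \<Rightarrow> 'a ell2" is "\<lambda>f h g. f g - h g"
  subgoal for f h using ell2_add_summable[of f "\<lambda>g. - h g"] by simp
  done

definition scaleR_ell2 :: "real \<Rightarrow> 'a ell2 \<Rightarrow> 'a ell2" where
  "scaleR_ell2 r x = complex_of_real r *\<^sub>C x"

definition inner_ell2 :: "'a ell2 \<Rightarrow> 'a ell2 \<Rightarrow> real" where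
  "inner_ell2 x y = Re (cinner x y)"

definition norm_ell2 :: "'a ell2 \<Rightarrow> real" where
  "norm_ell2 x = sqrt (\<Sum>\<^sub>\<infinity>g. (cmod (ell2_apply x g))\<^sup>2)"

definition sgn_ell2 :: "'a ell2 \<Rightarrow> 'a ell2" where
  "sgn_ell2 x = inverse (norm x) *\<^sub>R x"

definition dist_ell2 :: "'a ell2 \<Rightarrow> 'a ell2 \<Rightarrow> real" where
  "dist_ell2 x y = norm (x - y)"

definition uniformity_ell2 :: "('a ell2 \<times> 'a ell2) filter" where
  "uniformity_ell2 = (INF e\<in>{0<..}. principal {(x, y). dist x y < e})"

definition open_ell2 :: "'a ell2 set \<Rightarrow> bool" where
  "open_ell2 U = (\<forall>x\<in>U. \<forall>\<^sub>F (x', y) in uniformity. x' = x \<longrightarrow> y \<in> U)"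

instance
proof
  fix x y z :: "'a ell2" and r s :: real
  note [simp] = scaleR_ell2_def zero_ell2.rep_eq plus_ell2.rep_eq uminus_ell2.rep_eq
    minus_ell2.rep_eq cscale.rep_eq
  show "x + y + z = x + (y + z)" "x + y = y + x" "0 + x = x" "- x + x = 0" "x - y = x + - y"
    "r *\<^sub>R (x + y) = r *\<^sub>R x + r *\<^sub>R y" "(r + s) *\<^sub>R x = r *\<^sub>R x + s *\<^sub>R x"
    "r *\<^sub>R s *\<^sub>R x = (r * s) *\<^sub>R x" "1 *\<^sub>R x = x"
    by (auto intro!: ell2_eqI simp: algebra_simps)
  show "dist x y = norm (x - y)" by (rule dist_ell2_def)
  show "sgn x = inverse (norm x) *\<^sub>R x" by (rule sgn_ell2_def)
  show "uniformity = (INF e\<in>{0<..}. principal {(x, y :: 'a ell2). dist x y < e})"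
    by (rule uniformity_ell2_def)
  show "open U = (\<forall>x\<in>U. \<forall>\<^sub>F (x', y) in uniformity. x' = x \<longrightarrow> y \<in> U)" for U :: "'a ell2 set"
    by (rule open_ell2_def)
  have sum: "(\<lambda>g. ell2_apply u g * cnj (ell2_apply v g)) summable_on UNIV" for u v :: "'a ell2"
    by (intro ell2_mult_summable ell2_summable)
  have "cinner x y = cnj (cinner y x)"
    unfolding cinner_def infsum_cnj[symmetric] by (simp add: mult.commute)
  then show "inner x y = inner y x" by (simp add: inner_ell2_def)
  show "inner (x + y) z = inner x z + inner y z"
    unfolding inner_ell2_def cinner_def
    by (simp add: distrib_right infsum_add[OF sum sum])
  show "inner (r *\<^sub>R x) y = r * inner x y"
    unfolding inner_ell2_def cinner_def
    by (simp add: mult.assoc infsum_cmult_right')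
  have norm_sq: "inner x x = (\<Sum>\<^sub>\<infinity>g. (cmod (ell2_apply x g))\<^sup>2)"
    unfolding inner_ell2_def cinner_def infsum_Re[OF sum, symmetric]
    by (simp add: complex_norm_square[symmetric] Re_complex_of_real flip: of_real_power)
  show "0 \<le> inner x x" unfolding norm_sq by (rule infsum_nonneg) simp
  show "norm x = sqrt (inner x x)" unfolding norm_sq by (rule norm_ell2_def)
  show "inner x x = 0 \<longleftrightarrow> x = 0"
  proof
    assume "inner x x = 0"
    then have "(cmod (ell2_apply x g))\<^sup>2 = 0" for g
      unfolding norm_sq
      using nonneg_infsum_le_0D[OF _ ell2_summable[of x], of g] by simp
    then show "x = 0" by (auto intro!: ell2_eqI)
  qed (simp add: inner_ell2_def cinner_def)
qed

end

lemma cscale_vector_space: "vector_space (cscale :: complex \<Rightarrow> 'g ell2 \<Rightarrow> 'g ell2)"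
  by unfold_locales
    (auto intro!: ell2_eqI simp: cscale.rep_eq plus_ell2.rep_eq algebra_simps)

global_interpretation ell2: vector_space "cscale :: complex \<Rightarrow> 'g ell2 \<Rightarrow> 'g ell2"
  by (rule cscale_vector_space)

lemma norm_cscale: "norm (c *\<^sub>C x) = cmod c * norm x"
  by (simp add: norm_ell2_def cscale.rep_eq norm_mult power_mult_distrib infsum_cmult_right'
      real_sqrt_mult)

lift_definition delta :: "'g \<Rightarrow> 'g ell2" is "\<lambda>h g. if g = h then 1 else 0"
  by (rule finite_nonzero_values_imp_summable_on) simp

text \<open>
  Operators are elements of the type of bounded \<^emph>\<open>real\<close>-linear maps; complex linearity
  is a separate predicate.
\<close>

type_synonym 'g op = "'g ell2 \<Rightarrow>\<^sub>L 'g ell2"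

definition complex_linear :: "'g op \<Rightarrow> bool" where
  "complex_linear T \<longleftrightarrow> (\<forall>c x. T (c *\<^sub>C x) = c *\<^sub>C T x)"

definition op_scale :: "complex \<Rightarrow> 'g op \<Rightarrow> 'g op" (infixr \<open>\<cdot>\<^sub>C\<close> 75) where
  "c \<cdot>\<^sub>C T = Blinfun (\<lambda>x. c *\<^sub>C T x)"

lemma op_scale_apply: "(c \<cdot>\<^sub>C T) x = c *\<^sub>C T x"
proof -
  have "bounded_linear (\<lambda>x. c *\<^sub>C T x)"
    by (rule bounded_linear_compose[OF _ blinfun.bounded_linear_right],
        rule bounded_linear_intro[where K = "cmod c"])
      (auto simp: ell2.scale_right_distrib norm_cscale scaleR_ell2_def mult.commute)
  then show ?thesis
    by (simp add: op_scale_def bounded_linear_Blinfun_apply)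
qed

global_interpretation op: vector_space "op_scale :: complex \<Rightarrow> 'g op \<Rightarrow> 'g op"
  by unfold_locales
    (auto intro!: blinfun_eqI simp: op_scale_apply plus_blinfun.rep_eq ell2.scale_right_distrib
      ell2.scale_left_distrib)

definition compact_op :: "'g op \<Rightarrow> bool" where
  "compact_op T \<longleftrightarrow> complex_linear T \<and> compact (closure (T ` cball 0 1))"

definition finite_rank_op :: "'g op \<Rightarrow> bool" where
  "finite_rank_op T \<longleftrightarrow> complex_linear T \<and> (\<exists>B. finite B \<and> range T \<subseteq> ell2.span B)"

text \<open>The \<open>s\<^sup>2\<close>-eigenspace of \<open>T\<^sup>*T\<close>: the equation \<open>T\<^sup>*T x = s\<^sup>2 x\<close>, paired with all \<open>y\<close>.\<close>

definition singular_space :: "'g op \<Rightarrow> real \<Rightarrow> 'g ell2 set" where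
  "singular_space T s = {x. \<forall>y. cinner (T x) (T y) = complex_of_real (s\<^sup>2) * cinner x y}"

text \<open>
  For finite \<open>p\<close> the sum is that of the \<open>p\<close>-th powers of the nonzero eigenvalues of \<open>|T|\<close>, counted
  with (complex) multiplicity, i.e. the trace of \<open>|T|\<^sup>p\<close>. Compactness makes the eigenspaces
  finite-dimensional.
\<close>

definition schatten :: "ennreal \<Rightarrow> 'g op \<Rightarrow> bool" where
  "schatten p T \<longleftrightarrow> compact_op T \<and>
     (p \<noteq> \<infinity> \<longrightarrow>
        (\<lambda>s. real (ell2.dim (singular_space T s)) * s powr enn2real p) summable_on {0<..})"

lemma bij_add_left: "bij ((+) (g :: 'g::group_add))"
  by (rule o_bij[where g = "(+) (- g)"]) (auto simp: fun_eq_iff add.assoc[symmetric])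

lift_definition lreg_fun :: "'g::group_add \<Rightarrow> 'g ell2 \<Rightarrow> 'g ell2" is "\<lambda>g f h. f (- g + h)"
  subgoal for g f
    using summable_on_reindex_bij_betw[OF bij_add_left[of "- g"], of "\<lambda>h. (cmod (f h))\<^sup>2"]
    by simp
  done

lemma norm_lreg_fun: "norm (lreg_fun g x) = norm x"
  using infsum_reindex_bij_betw[OF bij_add_left[of "- g"], of "\<lambda>h. (cmod (ell2_apply x h))\<^sup>2"]
  by (simp add: norm_ell2_def lreg_fun.rep_eq)

definition lreg :: "'g::group_add \<Rightarrow> 'g op" where
  "lreg g = Blinfun (lreg_fun g)"

lemma lreg_apply: "lreg g x = lreg_fun g x"
proof -
  have "bounded_linear (lreg_fun g)"
    by (rule bounded_linear_intro[where K = 1])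
      (auto intro!: ell2_eqI simp: norm_lreg_fun lreg_fun.rep_eq plus_ell2.rep_eq scaleR_ell2_def
        cscale.rep_eq)
  then show ?thesis
    by (simp add: lreg_def bounded_linear_Blinfun_apply)
qed

definition group_alg :: "'g::group_add op set" where
  "group_alg = op.span (range lreg)"

definition group_vN :: "'g::group_add op set" where
  "group_vN = strong_operator_topology closure_of group_alg"

definition trace_vN :: "'g::group_add op \<Rightarrow> complex" where
  "trace_vN x = cinner (x (delta 0)) (delta 0)"

text \<open>
  Compact sets of the discrete group are finite, whence \<open>finite\<close>.
\<close>

definition proper_fun :: "('g \<Rightarrow> 'b::topological_space) \<Rightarrow> bool" where
  "proper_fun \<psi> \<longleftrightarrow> (\<forall>K. compact K \<longrightarrow> finite (\<psi> -` K))"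

definition symmetric_fun :: "('g::group_add \<Rightarrow> 'b) \<Rightarrow> bool" where
  "symmetric_fun \<psi> \<longleftrightarrow> (\<forall>s. \<psi> s = \<psi> (- s))"

definition cond_neg_type :: "('g::group_add \<Rightarrow> real) \<Rightarrow> bool" where
  "cond_neg_type \<psi> \<longleftrightarrow> \<psi> 0 = 0 \<and> symmetric_fun \<psi> \<and>
     (\<forall>n (s :: nat \<Rightarrow> 'g) (c :: nat \<Rightarrow> real). (\<Sum>i<n. c i) = 0 \<longrightarrow>
        (\<Sum>i<n. \<Sum>j<n. c i * c j * \<psi> (- s j + s i)) \<le> 0)"

definition linear_map_vN :: "('g::group_add op \<Rightarrow> 'g op) \<Rightarrow> bool" where
  "linear_map_vN F \<longleftrightarrow>
     (\<forall>x\<in>group_vN. F x \<in> group_vN) \<and>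
     (\<forall>x\<in>group_vN. \<forall>y\<in>group_vN. F (x + y) = F x + F y) \<and>
     (\<forall>c. \<forall>x\<in>group_vN. F (c \<cdot>\<^sub>C x) = c \<cdot>\<^sub>C F x)"

text \<open>
  Normality is \<open>\<sigma>\<close>-weak continuity: \<open>F\<close> pulls back the functionals
  \<open>x \<mapsto> \<Sum>n. \<langle>x \<xi>\<^sub>n, \<eta>\<^sub>n\<rangle>\<close>, with \<open>\<xi>\<close> and \<open>\<eta>\<close> square-summable, to functionals of the same form.
\<close>

definition square_summable :: "(nat \<Rightarrow> 'g ell2) \<Rightarrow> bool" where
  "square_summable \<xi> \<longleftrightarrow> summable (\<lambda>n. (norm (\<xi> n))\<^sup>2)"

definition normal_map_vN :: "('g::group_add op \<Rightarrow> 'g op) \<Rightarrow> bool" where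
  "normal_map_vN F \<longleftrightarrow>
     (\<forall>\<xi> \<eta>. square_summable \<xi> \<and> square_summable \<eta> \<longrightarrow>
        (\<exists>\<xi>' \<eta>'. square_summable \<xi>' \<and> square_summable \<eta>' \<and>
           (\<forall>x\<in>group_vN. (\<Sum>n. cinner (F x (\<xi> n)) (\<eta> n)) = (\<Sum>n. cinner (x (\<xi>' n)) (\<eta>' n)))))"

text \<open>Positivity of an \<open>n \<times> n\<close> operator matrix acting on the \<open>n\<close>-fold direct sum.\<close>

definition pos_op_matrix :: "nat \<Rightarrow> (nat \<Rightarrow> nat \<Rightarrow> 'g op) \<Rightarrow> bool" where
  "pos_op_matrix n X \<longleftrightarrow>
     (\<forall>\<xi>. (\<Sum>i<n. \<Sum>j<n. cinner (X i j (\<xi> j)) (\<xi> i)) \<in> \<real>\<^sub>\<ge>\<^sub>0)"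

definition completely_positive_vN :: "('g::group_add op \<Rightarrow> 'g op) \<Rightarrow> bool" where
  "completely_positive_vN F \<longleftrightarrow>
     (\<forall>n X. (\<forall>i<n. \<forall>j<n. X i j \<in> group_vN) \<and> pos_op_matrix n X
        \<longrightarrow> pos_op_matrix n (\<lambda>i j. F (X i j)))"

definition quantum_markov_semigroup :: "(real \<Rightarrow> 'g::group_add op \<Rightarrow> 'g op) \<Rightarrow> bool" where
  "quantum_markov_semigroup \<Phi> \<longleftrightarrow>
     (\<forall>x\<in>group_vN. \<Phi> 0 x = x) \<and>
     (\<forall>s\<ge>0. \<forall>t\<ge>0. \<forall>x\<in>group_vN. \<Phi> (s + t) x = \<Phi> s (\<Phi> t x)) \<and>
     (\<forall>t\<ge>0. linear_map_vN (\<Phi> t) \<and> normal_map_vN (\<Phi> t) \<and> completely_positive_vN (\<Phi> t) \<and>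
        \<Phi> t id_blinfun = id_blinfun \<and> (\<forall>x\<in>group_vN. trace_vN (\<Phi> t x) = trace_vN x))"

definition associated_semigroup ::
    "('g::group_add \<Rightarrow> real) \<Rightarrow> (real \<Rightarrow> 'g op \<Rightarrow> 'g op) \<Rightarrow> bool" where
  "associated_semigroup \<psi> \<Phi> \<longleftrightarrow> quantum_markov_semigroup \<Phi> \<and>
     (\<forall>t\<ge>0. \<forall>g. \<Phi> t (lreg g) = complex_of_real (exp (- t * \<psi> g)) \<cdot>\<^sub>C lreg g)"

lemma lreg_delta: "lreg g (delta h) = delta (g + h)"
proof -
  have "- g + k = h \<longleftrightarrow> k = g + h" for k
    by (metis add.assoc add.right_inverse add_0 left_minus)
  then show ?thesis
    by (intro ell2_eqI) (simp add: lreg_apply lreg_fun.rep_eq delta.rep_eq)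
qed

lemma associated_semigroup_unique:
  assumes "associated_semigroup \<psi> \<Phi>" "associated_semigroup \<phi> \<Phi>"
  shows "\<psi> = \<phi>"
proof
  fix g
  have "complex_of_real (exp (- \<psi> g)) \<cdot>\<^sub>C lreg g = complex_of_real (exp (- \<phi> g)) \<cdot>\<^sub>C lreg g"
    using assms unfolding associated_semigroup_def
    by (metis mult_minus1 zero_le_one)
  then have "ell2_apply ((complex_of_real (exp (- \<psi> g)) \<cdot>\<^sub>C lreg g) (delta 0)) g =
      ell2_apply ((complex_of_real (exp (- \<phi> g)) \<cdot>\<^sub>C lreg g) (delta 0)) g"
    by (rule arg_cong)
  then show "\<psi> g = \<phi> g"
    by (simp add: op_scale_apply cscale.rep_eq lreg_delta delta.rep_eq)
qed

text \<open>The coefficient of \<open>x\<close> at \<open>\<lambda>\<^sub>g\<close>, for \<open>x\<close> in the group algebra.\<close>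

definition coefficient :: "'g::group_add op \<Rightarrow> 'g \<Rightarrow> complex" where
  "coefficient x g = ell2_apply (x (delta 0)) g"

definition Delta :: "('g::group_add \<Rightarrow> real) \<Rightarrow> 'g op \<Rightarrow> 'g op" where
  "Delta \<psi> x = (\<Sum>g | coefficient x g \<noteq> 0. (complex_of_real (\<psi> g) * coefficient x g) \<cdot>\<^sub>C lreg g)"

lemma coefficient_sum:
  assumes "finite A"
  shows "coefficient (\<Sum>h\<in>A. c h \<cdot>\<^sub>C lreg h) g = (if g \<in> A then c g else 0)"
  using assms
proof induction
  case empty
  then show ?case by (simp add: coefficient_def zero_ell2.rep_eq)
next
  case (insert h A)
  then show ?case
    by (auto simp: coefficient_def plus_blinfun.rep_eq plus_ell2.rep_eq op_scale_apply
        cscale.rep_eq lreg_delta delta.rep_eq)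
qed

text \<open>\<open>Delta\<close> is the linear extension of \<open>\<lambda>\<^sub>g \<mapsto> \<psi>(g) \<lambda>\<^sub>g\<close> to the group algebra.\<close>

lemma Delta_sum:
  assumes "finite A"
  shows "Delta \<psi> (\<Sum>h\<in>A. c h \<cdot>\<^sub>C lreg h) = (\<Sum>h\<in>A. (complex_of_real (\<psi> h) * c h) \<cdot>\<^sub>C lreg h)"
proof -
  have "{g. (if g \<in> A then c g else 0) \<noteq> 0} = {g \<in> A. c g \<noteq> 0}" by auto
  then have "Delta \<psi> (\<Sum>h\<in>A. c h \<cdot>\<^sub>C lreg h) =
      (\<Sum>g\<in>{g \<in> A. c g \<noteq> 0}. (complex_of_real (\<psi> g) * c g) \<cdot>\<^sub>C lreg g)"
    unfolding Delta_def coefficient_sum[OF assms] by (auto intro!: sum.cong)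
  also have "\<dots> = (\<Sum>h\<in>A. (complex_of_real (\<psi> h) * c h) \<cdot>\<^sub>C lreg h)"
    using assms by (intro sum.mono_neutral_left) auto
  finally show ?thesis .
qed

definition Psi :: "('g::group_add \<Rightarrow> real) \<Rightarrow> 'g op \<Rightarrow> 'g op \<Rightarrow> 'g op \<Rightarrow> 'g op" where
  "Psi \<psi> a b x = Delta \<psi> (a o\<^sub>L x o\<^sub>L b) + (a o\<^sub>L Delta \<psi> x o\<^sub>L b)
     - (Delta \<psi> (a o\<^sub>L x) o\<^sub>L b) - (a o\<^sub>L Delta \<psi> (x o\<^sub>L b))"

text \<open>\<open>T\<close> extends a map \<open>P\<close> on the group algebra along the embedding \<open>x \<mapsto> x \<delta>\<^sub>e\<close>.\<close>

definition extends_to :: "('g::group_add op \<Rightarrow> 'g op) \<Rightarrow> 'g op \<Rightarrow> bool" where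
  "extends_to P T \<longleftrightarrow> (\<forall>x\<in>group_alg. T ((x :: 'g op) (delta 0)) = P x (delta 0))"

text \<open>The function \<open>\<psi>\<close> below is unique by \<open>associated_semigroup_unique\<close>.\<close>

definition gradient_schatten :: "ennreal \<Rightarrow> (real \<Rightarrow> 'g::group_add op \<Rightarrow> 'g op) \<Rightarrow> bool" where
  "gradient_schatten p \<Phi> \<longleftrightarrow>
     (\<exists>\<psi>. associated_semigroup \<psi> \<Phi> \<and>
        (\<forall>a\<in>group_alg. \<forall>b\<in>group_alg. \<exists>T. schatten p T \<and> extends_to (Psi \<psi> a b) T))"

definition gamma_fun :: "('g::group_add \<Rightarrow> 'b::ab_group_add) \<Rightarrow> 'g \<Rightarrow> 'g \<Rightarrow> 'g \<Rightarrow> 'b" where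
  "gamma_fun \<psi> u w v = \<psi> (u + v + w) + \<psi> v - \<psi> (u + v) - \<psi> (v + w)"

end

theory Submission
  imports Defs
begin

text \<open>
  The extension of \<open>\<Psi>\<close> for \<open>a = \<lambda>\<^sub>u\<close>, \<open>b = \<lambda>\<^sub>v\<close> maps \<open>\<delta>\<^sub>g\<close> to \<open>\<gamma>(g) \<delta>\<^bsub>ugv\<^esub>\<close>. These vectors are pairwise
  orthogonal and, \<open>\<gamma>\<close> being integer valued, of norm at least 1 where they do not vanish; a compact
  operator allows only finitely many of them. Hence \<open>\<gamma>\<close> has finite support, the extension is a
  finite sum of matrix units, and by bilinearity of \<open>\<Psi>\<close> in \<open>a, b\<close> every extension has finite rank.
  A finite rank operator has only finitely many nonzero singular values, since eigenvectors to
  different ones have nonzero orthogonal images.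
\<close>

subsection \<open>The inner product\<close>

lemma cinner_summable: "(\<lambda>g. ell2_apply x g * cnj (ell2_apply y g)) summable_on UNIV"
  by (intro ell2_mult_summable ell2_summable)

lemma cinner_commute: "cinner x y = cnj (cinner y x)"
  unfolding cinner_def infsum_cnj[symmetric] by (simp add: mult.commute)

lemma cinner_add_left: "cinner (x + y) z = cinner x z + cinner y z"
  unfolding cinner_def
  by (simp add: plus_ell2.rep_eq distrib_right infsum_add[OF cinner_summable cinner_summable])

lemma cinner_scale_left: "cinner (c *\<^sub>C x) y = c * cinner x y"
  unfolding cinner_def by (simp add: cscale.rep_eq mult.assoc infsum_cmult_right')

lemma cinner_zero_left: "cinner 0 y = 0"
  by (simp add: cinner_def zero_ell2.rep_eq)

lemma cinner_self_eq_0_iff: "cinner x x = 0 \<longleftrightarrow> x = 0"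
proof
  assume "cinner x x = 0"
  then have "inner x x = 0" by (simp add: inner_ell2_def)
  then show "x = 0" by simp
qed (simp add: cinner_zero_left)

text \<open>Coordinates are functionals of norm at most 1. This makes matrix units bounded and turns
  one large coordinate into a lower bound for a distance.\<close>

lemma cmod_ell2_apply_le_norm: "cmod (ell2_apply x g) \<le> norm x"
proof -
  have "(\<Sum>g\<in>{g}. (cmod (ell2_apply x g))\<^sup>2) \<le> (\<Sum>\<^sub>\<infinity>g. (cmod (ell2_apply x g))\<^sup>2)"
    by (rule finite_sum_le_infsum[OF ell2_summable]) auto
  then show ?thesis
    by (simp add: norm_ell2_def real_le_rsqrt)
qed

lemma norm_delta: "norm (delta g) = 1"
proof -
  have "(\<Sum>\<^sub>\<infinity>h. (cmod (ell2_apply (delta g) h))\<^sup>2) = (\<Sum>\<^sub>\<infinity>h\<in>{g}. (cmod (ell2_apply (delta g) h))\<^sup>2)"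
    by (rule infsum_cong_neutral) (auto simp: delta.rep_eq)
  then show ?thesis
    by (simp add: norm_ell2_def delta.rep_eq)
qed

text \<open>If \<open>a\<close> lies in the span of the other vectors, then the subspace of all
  \<open>y\<close> with \<open>cinner y a = 0\<close> contains those vectors, hence \<open>a\<close>
  itself, which forces \<open>a = 0\<close>.\<close>

lemma orthogonal_imp_independent:
  assumes "0 \<notin> B" and orth: "\<And>x y. x \<in> B \<Longrightarrow> y \<in> B \<Longrightarrow> x \<noteq> y \<Longrightarrow> cinner x y = 0"
  shows "ell2.independent B"
proof
  assume "ell2.dependent B"
  then obtain a where a: "a \<in> B" "a \<in> ell2.span (B - {a})"
    unfolding ell2.dependent_def by blast
  have "cinner a a = 0"
  proof (rule ell2.span_induct[where P = "\<lambda>y. cinner y a = 0", OF a(2)])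
    show "cinner y a = 0" if "y \<in> B - {a}" for y
      using that orth a(1) by auto
    show "ell2.subspace {y. cinner y a = 0}"
      by (rule ell2.subspaceI)
        (auto simp: cinner_zero_left cinner_add_left cinner_scale_left)
  qed
  with a(1) \<open>0 \<notin> B\<close> show False by (simp add: cinner_self_eq_0_iff)
qed

subsection \<open>Finite rank operators\<close>

text \<open>The usual orthogonality of eigenvectors of a self-adjoint operator, without forming the
  adjoint: \<open>cinner (T x) (T y)\<close> is computed once from \<open>x\<close> and once from
  \<open>y\<close>.\<close>

lemma cinner_singular_space_eq_0:
  assumes "x \<in> singular_space T s" "y \<in> singular_space T t" "0 < s" "0 < t" "s \<noteq> t"
  shows "cinner x y = 0"
proof -
  have 1: "cinner (T x) (T y) = complex_of_real (s\<^sup>2) * cinner x y"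
    using assms(1) by (simp add: singular_space_def)
  have "cinner (T y) (T x) = complex_of_real (t\<^sup>2) * cinner y x"
    using assms(2) by (simp add: singular_space_def)
  \<comment> \<open>Conjugation restores the order of the arguments and fixes the real
    eigenvalue.\<close>
  then have "cnj (cinner (T y) (T x)) = cnj (complex_of_real (t\<^sup>2) * cinner y x)" by simp
  then have "cinner (T x) (T y) = complex_of_real (t\<^sup>2) * cinner x y"
    by (simp add: cinner_commute[symmetric])
  with 1 have "complex_of_real (s\<^sup>2) * cinner x y = complex_of_real (t\<^sup>2) * cinner x y"
    by (rule trans[OF sym])
  moreover have "complex_of_real (s\<^sup>2) \<noteq> complex_of_real (t\<^sup>2)"
    unfolding of_real_eq_iff using assms(3-5) by (simp add: power2_eq_iff)
  ultimately show ?thesis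
    unfolding mult_cancel_right by blast
qed

text \<open>Independence is proved for the images of the eigenvectors, since it is the images that
  lie in the span of the finite set \<open>B\<close>, which then bounds their number.\<close>

lemma finite_rank_finite_singular_values:
  assumes "finite_rank_op T"
  shows "finite {s. 0 < s \<and> \<not> singular_space T s \<subseteq> {0}}"
proof -
  define S where "S = {s. 0 < s \<and> \<not> singular_space T s \<subseteq> {0}}"
  obtain B where B: "finite B" "range T \<subseteq> ell2.span B"
    using assms unfolding finite_rank_op_def by blast
  have "\<forall>s\<in>S. \<exists>x. x \<in> singular_space T s \<and> x \<noteq> 0"
    unfolding S_def by blast
  then obtain x where x: "x s \<in> singular_space T s" "x s \<noteq> 0" if "s \<in> S" for s
    by metis
  have inner: "cinner (T (x s)) (T y) = complex_of_real (s\<^sup>2) * cinner (x s) y" if "s \<in> S" for s y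
    using x(1)[OF that] by (simp add: singular_space_def)
  have orth: "cinner (T (x s)) (T (x t)) = 0" if "s \<in> S" "t \<in> S" "s \<noteq> t" for s t
    using that cinner_singular_space_eq_0[OF x(1)[OF that(1)] x(1)[OF that(2)]]
    by (simp add: inner S_def)
  \<comment> \<open>The squared norm of \<open>T (x s)\<close> is \<open>s\<^sup>2\<close> times
    that of \<open>x s\<close>.\<close>
  have nz: "T (x s) \<noteq> 0" if "s \<in> S" for s
  proof
    assume "T (x s) = 0"
    then have "complex_of_real (s\<^sup>2) * cinner (x s) (x s) = 0"
      using inner[OF that, of "x s"] by (simp add: cinner_zero_left)
    then show False
      using x(2)[OF that] that by (simp add: cinner_self_eq_0_iff S_def)
  qed
  \<comment> \<open>Injectivity carries finiteness from the set of images back to \<open>S\<close>: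
    a vector that is the image for two different values would be orthogonal to itself.\<close>
  have inj: "inj_on (\<lambda>s. T (x s)) S"
  proof (rule inj_onI, rule ccontr)
    fix s t assume st: "s \<in> S" "t \<in> S" "T (x s) = T (x t)" "s \<noteq> t"
    then have "cinner (T (x s)) (T (x s)) = 0" using orth by metis
    with nz st(1) show False by (simp add: cinner_self_eq_0_iff)
  qed
  have "ell2.independent ((\<lambda>s. T (x s)) ` S)"
    by (rule orthogonal_imp_independent) (use nz orth in \<open>force+\<close>)
  then have "finite ((\<lambda>s. T (x s)) ` S)"
    using ell2.independent_span_bound[OF B(1)] B(2) by blast
  then show ?thesis
    using finite_imageD inj unfolding S_def by blast
qed

text \<open>Whatever the exponent, a term of the sum can be nonzero only at one of the finitely many
  singular values; elsewhere the eigenspace lies in \<open>{0}\<close>, the span of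
  \<open>{}\<close>, and has dimension 0.\<close>

lemma finite_rank_compact_imp_schatten:
  assumes "finite_rank_op T" "compact_op T"
  shows "schatten p T"
proof -
  have "(\<lambda>s. real (ell2.dim (singular_space T s)) * s powr q) summable_on {0<..}" for q
  proof (rule finite_nonzero_values_imp_summable_on)
    have "ell2.dim (singular_space T s) = 0" if "singular_space T s \<subseteq> {0}" for s
      using that ell2.dim_le_card[of "singular_space T s" "{}"] by simp
    then have "{s \<in> {0<..}. real (ell2.dim (singular_space T s)) * s powr q \<noteq> 0}
        \<subseteq> {s. 0 < s \<and> \<not> singular_space T s \<subseteq> {0}}"
      by auto
    then show "finite {s \<in> {0<..}. real (ell2.dim (singular_space T s)) * s powr q \<noteq> 0}"
      using finite_rank_finite_singular_values[OF assms(1)] finite_subset by blast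
  qed
  with assms(2) show ?thesis by (simp add: schatten_def)
qed

section \<open>Linear combinations of finite rank and compact operators\<close>

lemma complex_linear_zero: "complex_linear 0"
  by (simp add: complex_linear_def)

lemma complex_linear_add: "complex_linear S \<Longrightarrow> complex_linear T \<Longrightarrow> complex_linear (S + T)"
  by (simp add: complex_linear_def plus_blinfun.rep_eq ell2.scale_right_distrib)

lemma complex_linear_scale: "complex_linear T \<Longrightarrow> complex_linear (c \<cdot>\<^sub>C T)"
  by (simp add: complex_linear_def op_scale_apply mult.commute)

lemma finite_rank_op_add:
  assumes "finite_rank_op S" "finite_rank_op T"
  shows "finite_rank_op (S + T)"
proof -
  obtain B C where BC: "finite B" "finite C" "range S \<subseteq> ell2.span B" "range T \<subseteq> ell2.span C"
    using assms unfolding finite_rank_op_def by blast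
  have "S x + T x \<in> ell2.span (B \<union> C)" for x
    using BC ell2.span_mono[of B "B \<union> C"] ell2.span_mono[of C "B \<union> C"]
    by (intro ell2.span_add) auto
  then have "range (S + T) \<subseteq> ell2.span (B \<union> C)"
    by (auto simp: plus_blinfun.rep_eq)
  with BC assms show ?thesis
    unfolding finite_rank_op_def using complex_linear_add by blast
qed

lemma finite_rank_op_scale:
  assumes "finite_rank_op T"
  shows "finite_rank_op (c \<cdot>\<^sub>C T)"
proof -
  obtain B where B: "finite B" "range T \<subseteq> ell2.span B"
    using assms unfolding finite_rank_op_def by blast
  then have "range (c \<cdot>\<^sub>C T) \<subseteq> ell2.span B"
    by (auto simp: op_scale_apply intro!: ell2.span_scale)
  with B assms show ?thesis
    unfolding finite_rank_op_def using complex_linear_scale by blast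
qed

text \<open>A closed subset of a compact set is compact, so it suffices to trap the image of the
  unit ball in some compact \<open>K\<close>.\<close>

lemma compact_opI:
  assumes "complex_linear T" "compact K" "T ` cball 0 1 \<subseteq> K"
  shows "compact_op T"
proof -
  have "closure (T ` cball 0 1) \<subseteq> K"
    using assms(2,3) by (simp add: closure_minimal compact_imp_closed)
  with assms show ?thesis
    unfolding compact_op_def by (metis closed_closure compact_Int_closed inf.absorb_iff2)
qed

lemma compact_op_add:
  assumes "compact_op S" "compact_op T"
  shows "compact_op (S + T)"
proof (rule compact_opI)
  show "complex_linear (S + T)"
    using assms complex_linear_add unfolding compact_op_def by blast
  show "compact {x + y | x y. x \<in> closure (S ` cball 0 1) \<and> y \<in> closure (T ` cball 0 1)}"
    using assms by (intro compact_sums) (auto simp: compact_op_def)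
  show "(S + T) ` cball 0 1
      \<subseteq> {x + y | x y. x \<in> closure (S ` cball 0 1) \<and> y \<in> closure (T ` cball 0 1)}"
    using closure_subset[of "S ` cball 0 1"] closure_subset[of "T ` cball 0 1"]
    by (force simp: plus_blinfun.rep_eq)
qed

lemma bounded_linear_cscale: "bounded_linear (\<lambda>x. c *\<^sub>C x)"
  by (rule bounded_linear_intro[where K = "cmod c"])
    (auto simp: ell2.scale_right_distrib norm_cscale scaleR_ell2_def mult.commute)

lemma bounded_linear_cscale_left: "bounded_linear (\<lambda>c. c *\<^sub>C x)"
  by (rule bounded_linear_intro[where K = "norm x"])
    (auto simp: ell2.scale_left_distrib norm_cscale scaleR_ell2_def scaleR_conv_of_real)

lemma compact_op_scale:
  assumes "compact_op T"
  shows "compact_op (c \<cdot>\<^sub>C T)"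
proof (rule compact_opI)
  show "complex_linear (c \<cdot>\<^sub>C T)"
    using assms complex_linear_scale unfolding compact_op_def by blast
  show "compact ((\<lambda>x. c *\<^sub>C x) ` closure (T ` cball 0 1))"
    using assms
    by (intro compact_continuous_image linear_continuous_on bounded_linear_cscale)
      (auto simp: compact_op_def)
  show "(c \<cdot>\<^sub>C T) ` cball 0 1 \<subseteq> (\<lambda>x. c *\<^sub>C x) ` closure (T ` cball 0 1)"
    using closure_subset[of "T ` cball 0 1"] by (auto simp: op_scale_apply)
qed

text \<open>Finite rank and compactness travel together, so that a finite combination of matrix
  units acquires both at once.\<close>

lemma op_subspace_finite_rank_compact: "op.subspace {T. finite_rank_op T \<and> compact_op T}"
proof (rule op.subspaceI)
  have "finite_rank_op 0"
    unfolding finite_rank_op_def using complex_linear_zero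
    by (auto intro!: exI[of _ "{}"])
  moreover have "compact_op 0"
    by (rule compact_opI[where K = "{0}"]) (auto simp: complex_linear_zero)
  ultimately show "0 \<in> {T. finite_rank_op T \<and> compact_op T}" by simp
qed (auto intro: finite_rank_op_add compact_op_add finite_rank_op_scale compact_op_scale)

section \<open>Matrix units, and compact operators that map basis vectors to multiples of basis
  vectors\<close>

definition matrix_unit :: "'g \<Rightarrow> 'g \<Rightarrow> 'g op" where
  "matrix_unit h g = Blinfun (\<lambda>x. ell2_apply x g *\<^sub>C delta h)"

lemma matrix_unit_apply: "matrix_unit h g x = ell2_apply x g *\<^sub>C delta h"
proof -
  have "bounded_linear (\<lambda>x. ell2_apply x g)"
    by (rule bounded_linear_intro[where K = 1])
      (auto simp: plus_ell2.rep_eq scaleR_ell2_def cscale.rep_eq cmod_ell2_apply_le_norm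
        scaleR_conv_of_real)
  then have "bounded_linear (\<lambda>x. ell2_apply x g *\<^sub>C delta h)"
    by (rule bounded_linear_compose[OF bounded_linear_cscale_left])
  then show ?thesis
    by (simp add: matrix_unit_def bounded_linear_Blinfun_apply)
qed

lemma complex_linear_matrix_unit: "complex_linear (matrix_unit h g)"
  by (simp add: complex_linear_def matrix_unit_apply cscale.rep_eq)

lemma finite_rank_matrix_unit: "finite_rank_op (matrix_unit h g)"
proof -
  have "range (matrix_unit h g) \<subseteq> ell2.span {delta h}"
  proof
    fix y assume "y \<in> range (matrix_unit h g)"
    then obtain x where "y = ell2_apply x g *\<^sub>C delta h"
      by (auto simp: matrix_unit_apply)
    then show "y \<in> ell2.span {delta h}"
      by (metis ell2.span_scale ell2.span_base singletonI)
  qed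
  then show ?thesis
    unfolding finite_rank_op_def
    by (intro conjI exI[of _ "{delta h}"] complex_linear_matrix_unit) simp
qed

lemma compact_matrix_unit: "compact_op (matrix_unit h g)"
proof (rule compact_opI[OF complex_linear_matrix_unit])
  \<comment> \<open>The coordinate at \<open>g\<close> of a vector in the unit ball lies in the
    closed unit disc of the complex plane, which is compact.\<close>
  show "compact ((\<lambda>c. c *\<^sub>C delta h) ` cball 0 1)"
    by (intro compact_continuous_image linear_continuous_on bounded_linear_cscale_left) simp
  show "matrix_unit h g ` cball 0 1 \<subseteq> (\<lambda>c. c *\<^sub>C delta h) ` cball 0 1"
  proof
    fix y assume "y \<in> matrix_unit h g ` cball 0 1"
    then obtain x where "norm x \<le> 1" "y = ell2_apply x g *\<^sub>C delta h"
      by (auto simp: matrix_unit_apply)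
    then show "y \<in> (\<lambda>c. c *\<^sub>C delta h) ` cball 0 1"
      using cmod_ell2_apply_le_norm[of x g] by (intro image_eqI) auto
  qed
qed

text \<open>The images of the basis vectors with nonzero weight are at mutual distance at least 1,
  and a relatively compact set contains no infinite family of this kind. Integrality of
  \<open>w\<close> supplies the uniform bound.\<close>

lemma compact_op_finite_weights:
  assumes T: "compact_op T"
    and weights: "\<And>g. T (delta g) = complex_of_real (real_of_int (w g)) *\<^sub>C delta (\<sigma> g)"
    and "inj \<sigma>"
  shows "finite {g. w g \<noteq> 0}"
proof (rule ccontr)
  define S where "S = {g. w g \<noteq> 0}"
  define f where "f g = T (delta g)" for g
  assume "infinite {g. w g \<noteq> 0}"
  then have "infinite S" by (simp add: S_def)
  have dist: "1 \<le> dist (f g) (f h)" if "g \<in> S" "g \<noteq> h" for g h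
  proof -
    \<comment> \<open>At the coordinate \<open>\<sigma> g\<close> the vector \<open>f h\<close>
      vanishes, so the difference has there exactly the value \<open>w g\<close>.\<close>
    have "\<sigma> g \<noteq> \<sigma> h" using \<open>inj \<sigma>\<close> that(2) by (auto dest: injD)
    then have "ell2_apply (f g - f h) (\<sigma> g) = complex_of_real (real_of_int (w g))"
      by (simp add: f_def weights minus_ell2.rep_eq cscale.rep_eq delta.rep_eq)
    then have "\<bar>real_of_int (w g)\<bar> \<le> dist (f g) (f h)"
      using cmod_ell2_apply_le_norm[of "f g - f h" "\<sigma> g"]
      by (simp add: dist_norm norm_of_real del: of_real_of_int_eq)
    moreover have "1 \<le> \<bar>w g\<bar>" using that(1) by (simp add: S_def)
    ultimately show ?thesis by linarith
  qed
  have "inj_on f S"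
    using dist by (fastforce intro!: inj_onI)
  then have "infinite (f ` S)"
    using \<open>infinite S\<close> finite_imageD by blast
  moreover have "f ` S \<subseteq> closure (T ` cball 0 1)"
    using closure_subset[of "T ` cball 0 1"] by (auto simp: f_def norm_delta)
  moreover have "compact (closure (T ` cball 0 1))"
    using T by (simp add: compact_op_def)
  ultimately obtain x where "x islimpt f ` S"
    using Heine_Borel_imp_Bolzano_Weierstrass by blast
  then have inf: "infinite (f ` S \<inter> ball x (1/2))"
    by (simp add: islimpt_eq_infinite_ball)
  then obtain y where y: "y \<in> f ` S \<inter> ball x (1/2)"
    by (metis all_not_in_conv finite.emptyI)
  have "infinite (f ` S \<inter> ball x (1/2) - {y})" using inf by simp
  then obtain z where z: "z \<in> f ` S \<inter> ball x (1/2)" "z \<noteq> y"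
    by (metis DiffD1 DiffD2 all_not_in_conv finite.emptyI singletonI)
  obtain g h where "g \<in> S" "h \<in> S" "y = f g" "z = f h" using y z by blast
  with z(2) dist[of g h] have "1 \<le> dist y z" by auto
  moreover have "dist y z < 1/2 + 1/2"
    using y z(1) dist_triangle_less_add[of y x "1/2" z "1/2"]
    by (simp add: dist_commute)
  ultimately show False by simp
qed

subsection \<open>The group algebra\<close>

lemma group_alg_subspace: "op.subspace group_alg"
  unfolding group_alg_def by (rule op.subspace_span)

lemmas group_alg_add = op.subspace_add[OF group_alg_subspace]
lemmas group_alg_scale = op.subspace_scale[OF group_alg_subspace]
lemmas group_alg_sum = op.subspace_sum[OF group_alg_subspace]

lemma lreg_in_group_alg: "lreg g \<in> group_alg"
  unfolding group_alg_def by (simp add: op.span_base)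

text \<open>Membership in \<open>group_alg\<close> is carried through the induction because the
  linearity rules for \<open>Delta\<close> and \<open>Psi\<close> are available only there.\<close>

lemma group_alg_induct [consumes 1, case_names lreg add scale]:
  assumes "x \<in> group_alg"
    and "\<And>g. P (lreg g)"
    and "\<And>x y. x \<in> group_alg \<Longrightarrow> y \<in> group_alg \<Longrightarrow> P x \<Longrightarrow> P y \<Longrightarrow> P (x + y)"
    and "\<And>c x. x \<in> group_alg \<Longrightarrow> P x \<Longrightarrow> P (c \<cdot>\<^sub>C x)"
  shows "P x"
proof -
  have "x \<in> group_alg \<and> P x"
    using assms(1)[unfolded group_alg_def]
  proof (rule op.span_induct)
    \<comment> \<open>The zero operator is a multiple of a generator, so the rule asks for no case
      for it.\<close>
    have "P (0 \<cdot>\<^sub>C lreg 0)" by (intro assms(4) lreg_in_group_alg assms(2))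
    then have "P 0" by simp
    then show "op.subspace {x. x \<in> group_alg \<and> P x}"
      using assms(3,4) op.subspace_0[OF group_alg_subspace]
      by (intro op.subspaceI) (auto intro: group_alg_add group_alg_scale)
  qed (auto simp: lreg_in_group_alg assms(2))
  then show ?thesis ..
qed

lemma complex_linear_group_alg: "x \<in> group_alg \<Longrightarrow> complex_linear x"
proof (induction rule: group_alg_induct)
  case (lreg g)
  show ?case
    by (auto simp: complex_linear_def lreg_apply lreg_fun.rep_eq cscale.rep_eq intro!: ell2_eqI)
qed (auto intro: complex_linear_add complex_linear_scale)

lemma compose_scale_left: "(c \<cdot>\<^sub>C x) o\<^sub>L y = c \<cdot>\<^sub>C (x o\<^sub>L y)"
  by (rule blinfun_eqI) (simp add: op_scale_apply)

text \<open>The type \<open>op\<close> guarantees real linearity only; a complex scalar passes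
  through \<open>x\<close> because elements of the group algebra are complex linear.\<close>

lemma compose_scale_right: "x \<in> group_alg \<Longrightarrow> x o\<^sub>L (c \<cdot>\<^sub>C y) = c \<cdot>\<^sub>C (x o\<^sub>L y)"
  using complex_linear_group_alg[of x]
  by (intro blinfun_eqI) (simp add: op_scale_apply complex_linear_def)

lemma compose_add_left: "(x + y) o\<^sub>L z = (x o\<^sub>L z) + (y o\<^sub>L z)"
  by (rule blinfun_eqI) (simp add: plus_blinfun.rep_eq)

lemma compose_add_right: "x o\<^sub>L (y + z) = (x o\<^sub>L y) + (x o\<^sub>L z)"
  by (rule blinfun_eqI) (simp add: plus_blinfun.rep_eq blinfun.add_right)

lemma lreg_compose: "lreg g o\<^sub>L lreg h = lreg (g + h)"
proof (intro blinfun_eqI ell2_eqI)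
  fix x k
  have "- (g + h) + k = - h + (- g + k)"
    by (simp only: minus_add add.assoc)
  then show "ell2_apply ((lreg g o\<^sub>L lreg h) x) k = ell2_apply (lreg (g + h) x) k"
    by (simp add: lreg_apply lreg_fun.rep_eq)
qed

lemma group_alg_compose:
  assumes "x \<in> group_alg" "y \<in> group_alg"
  shows "x o\<^sub>L y \<in> group_alg"
  using assms(1)
proof (induction rule: group_alg_induct)
  case (lreg g)
  show ?case
    using assms(2)
    by (induction rule: group_alg_induct)
      (auto simp: lreg_compose compose_add_right compose_scale_right lreg_in_group_alg
        intro: group_alg_add group_alg_scale)
qed (auto simp: compose_add_left compose_scale_left intro: group_alg_add group_alg_scale)

lemma coefficient_add: "coefficient (x + y) g = coefficient x g + coefficient y g"
  by (simp add: coefficient_def plus_blinfun.rep_eq plus_ell2.rep_eq)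

lemma coefficient_scale: "coefficient (c \<cdot>\<^sub>C x) g = c * coefficient x g"
  by (simp add: coefficient_def op_scale_apply cscale.rep_eq)

lemma finite_coefficient: "x \<in> group_alg \<Longrightarrow> finite {g. coefficient x g \<noteq> 0}"
proof (induction rule: group_alg_induct)
  case (lreg g)
  show ?case by (simp add: coefficient_def lreg_delta delta.rep_eq)
next
  case (add x y)
  then show ?case
    by (rule_tac finite_subset[OF _ finite_UnI[OF add.IH]]) (auto simp: coefficient_add)
next
  case (scale c x)
  then show ?case
    by (rule_tac finite_subset[OF _ scale.IH]) (auto simp: coefficient_scale)
qed

text \<open>Allows \<open>Delta\<close> of several elements to be summed over one common finite
  index set and compared term by term.\<close>

lemma Delta_superset:
  assumes "finite A" "{g. coefficient x g \<noteq> 0} \<subseteq> A"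
  shows "Delta \<psi> x = (\<Sum>g\<in>A. (complex_of_real (\<psi> g) * coefficient x g) \<cdot>\<^sub>C lreg g)"
  unfolding Delta_def using assms by (intro sum.mono_neutral_left) auto

lemma Delta_lreg: "Delta \<psi> (lreg g) = complex_of_real (\<psi> g) \<cdot>\<^sub>C lreg g"
  using Delta_sum[of "{g}" \<psi> "\<lambda>_. 1"] by simp

lemma Delta_add:
  assumes "x \<in> group_alg" "y \<in> group_alg"
  shows "Delta \<psi> (x + y) = Delta \<psi> x + Delta \<psi> y"
proof -
  define A where "A = {g. coefficient x g \<noteq> 0} \<union> {g. coefficient y g \<noteq> 0}"
  have "finite A"
    using assms[THEN finite_coefficient] by (simp add: A_def)
  moreover have "{g. coefficient (x + y) g \<noteq> 0} \<subseteq> A"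
    by (auto simp: A_def coefficient_add)
  moreover have "{g. coefficient x g \<noteq> 0} \<subseteq> A" "{g. coefficient y g \<noteq> 0} \<subseteq> A"
    by (auto simp: A_def)
  ultimately show ?thesis
    by (simp add: Delta_superset coefficient_add distrib_left op.scale_left_distrib sum.distrib)
qed

lemma Delta_scale:
  assumes "x \<in> group_alg"
  shows "Delta \<psi> (c \<cdot>\<^sub>C x) = c \<cdot>\<^sub>C Delta \<psi> x"
proof -
  have "{g. coefficient (c \<cdot>\<^sub>C x) g \<noteq> 0} \<subseteq> {g. coefficient x g \<noteq> 0}"
    by (auto simp: coefficient_scale)
  from Delta_superset[OF finite_coefficient[OF assms] this] show ?thesis
    by (simp add: Delta_def coefficient_scale op.scale_sum_right mult.left_commute)
qed

lemma Delta_in_group_alg: "Delta \<psi> x \<in> group_alg"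
  unfolding Delta_def by (intro group_alg_sum group_alg_scale lreg_in_group_alg)

subsection \<open>The map \<open>\<Psi>\<close>\<close>

text \<open>These rules expand \<open>Psi\<close> by linearity of \<open>Delta\<close> and
  bilinearity of composition; the membership facts discharge their side conditions.\<close>

lemmas group_alg_simps = group_alg_compose Delta_in_group_alg Delta_add Delta_scale
  compose_add_left compose_add_right compose_scale_left compose_scale_right
  group_alg_add group_alg_scale op.scale_right_distrib op.scale_right_diff_distrib

lemma Psi_add_left:
  "a \<in> group_alg \<Longrightarrow> a' \<in> group_alg \<Longrightarrow> b \<in> group_alg \<Longrightarrow> x \<in> group_alg \<Longrightarrow>
    Psi \<psi> (a + a') b x = Psi \<psi> a b x + Psi \<psi> a' b x"
  by (simp only: Psi_def group_alg_simps) (simp add: algebra_simps)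

lemma Psi_add_middle:
  "a \<in> group_alg \<Longrightarrow> b \<in> group_alg \<Longrightarrow> b' \<in> group_alg \<Longrightarrow> x \<in> group_alg \<Longrightarrow>
    Psi \<psi> a (b + b') x = Psi \<psi> a b x + Psi \<psi> a b' x"
  by (simp only: Psi_def group_alg_simps) (simp add: algebra_simps)

lemma Psi_add_right:
  "a \<in> group_alg \<Longrightarrow> b \<in> group_alg \<Longrightarrow> x \<in> group_alg \<Longrightarrow> y \<in> group_alg \<Longrightarrow>
    Psi \<psi> a b (x + y) = Psi \<psi> a b x + Psi \<psi> a b y"
  by (simp only: Psi_def group_alg_simps) (simp add: algebra_simps)

lemma Psi_scale_left:
  "a \<in> group_alg \<Longrightarrow> b \<in> group_alg \<Longrightarrow> x \<in> group_alg \<Longrightarrow>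
    Psi \<psi> (c \<cdot>\<^sub>C a) b x = c \<cdot>\<^sub>C Psi \<psi> a b x"
  by (simp only: Psi_def group_alg_simps)

lemma Psi_scale_middle:
  "a \<in> group_alg \<Longrightarrow> b \<in> group_alg \<Longrightarrow> x \<in> group_alg \<Longrightarrow>
    Psi \<psi> a (c \<cdot>\<^sub>C b) x = c \<cdot>\<^sub>C Psi \<psi> a b x"
  by (simp only: Psi_def group_alg_simps)

lemma Psi_scale_right:
  "a \<in> group_alg \<Longrightarrow> b \<in> group_alg \<Longrightarrow> x \<in> group_alg \<Longrightarrow>
    Psi \<psi> a b (c \<cdot>\<^sub>C x) = c \<cdot>\<^sub>C Psi \<psi> a b x"
  by (simp only: Psi_def group_alg_simps)

text \<open>All four terms of \<open>Psi\<close> are multiples of \<open>lreg (u + g + v)\<close>;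
  their coefficients are the four values of \<open>\<psi>\<close> that make up
  \<open>gamma_fun\<close>.\<close>

lemma Psi_lreg:
  "Psi \<psi> (lreg u) (lreg v) (lreg g) = complex_of_real (gamma_fun \<psi> u v g) \<cdot>\<^sub>C lreg (u + g + v)"
  by (simp add: Psi_def Delta_lreg lreg_compose compose_scale_left compose_scale_right
      lreg_in_group_alg gamma_fun_def add.assoc op.scale_left_distrib op.scale_left_diff_distrib)

section \<open>Bounded extensions of \<open>Psi\<close>\<close>

lemma extends_to_Psi_delta:
  assumes "extends_to (Psi \<psi> (lreg u) (lreg v)) T"
  shows "T (delta g) = complex_of_real (gamma_fun \<psi> u v g) *\<^sub>C delta (u + g + v)"
proof -
  have "T (lreg g (delta 0)) = Psi \<psi> (lreg u) (lreg v) (lreg g) (delta 0)"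
    using assms lreg_in_group_alg unfolding extends_to_def by blast
  then show ?thesis
    by (simp add: lreg_delta Psi_lreg op_scale_apply)
qed

text \<open>Both sides of the extension equation are complex linear in \<open>x\<close>, so it is
  enough to check the generators, where \<open>lreg g (delta 0)\<close> is
  \<open>delta g\<close>.\<close>

lemma extends_to_Psi_lregI:
  assumes "complex_linear T"
    and delta: "\<And>g. T (delta g) = complex_of_real (gamma_fun \<psi> u v g) *\<^sub>C delta (u + g + v)"
  shows "extends_to (Psi \<psi> (lreg u) (lreg v)) T"
  unfolding extends_to_def
proof
  fix x :: "'a op"
  assume "x \<in> group_alg"
  then show "T (x (delta 0)) = Psi \<psi> (lreg u) (lreg v) x (delta 0)"
  proof (induction rule: group_alg_induct)
    case (lreg g)
    show ?case by (simp add: Psi_lreg lreg_delta op_scale_apply delta)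
  next
    case (add x y)
    then show ?case
      by (simp add: Psi_add_right lreg_in_group_alg plus_blinfun.rep_eq blinfun.add_right)
  next
    case (scale c x)
    then show ?case
      using assms(1)
      by (simp add: Psi_scale_right lreg_in_group_alg op_scale_apply complex_linear_def)
  qed
qed

lemma finite_rank_extension_lreg:
  assumes "finite {g. gamma_fun \<psi> u v g \<noteq> 0}"
  shows "\<exists>T. finite_rank_op T \<and> compact_op T \<and> extends_to (Psi \<psi> (lreg u) (lreg v)) T"
proof -
  define S where "S = {g. gamma_fun \<psi> u v g \<noteq> 0}"
  define T where
    "T = (\<Sum>g\<in>S. complex_of_real (gamma_fun \<psi> u v g) \<cdot>\<^sub>C matrix_unit (u + g + v) g)"
  have T: "finite_rank_op T \<and> compact_op T"
    using op.subspace_sum[OF op_subspace_finite_rank_compact, of S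
        "\<lambda>g. complex_of_real (gamma_fun \<psi> u v g) \<cdot>\<^sub>C matrix_unit (u + g + v) g"]
    by (simp add: T_def finite_rank_matrix_unit compact_matrix_unit finite_rank_op_scale
        compact_op_scale)
  have "T (delta k) = complex_of_real (gamma_fun \<psi> u v k) *\<^sub>C delta (u + k + v)" for k
  proof -
    \<comment> \<open>Only the matrix unit with column \<open>k\<close> acts on
      \<open>delta k\<close>. For \<open>k\<close> outside \<open>S\<close> no term survives, in
      agreement with a vanishing \<open>gamma_fun\<close>.\<close>
    have "T (delta k) = (\<Sum>g\<in>S. if g = k
        then complex_of_real (gamma_fun \<psi> u v k) *\<^sub>C delta (u + k + v) else 0)"
      unfolding T_def blinfun.sum_left
      by (intro sum.cong) (auto simp: op_scale_apply matrix_unit_apply delta.rep_eq)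
    then show ?thesis
      using assms by (auto simp: S_def)
  qed
  with T show ?thesis
    by (metis extends_to_Psi_lregI finite_rank_op_def)
qed

text \<open>\<open>R\<close> is tied to \<open>P\<close> and \<open>Q\<close> on the group algebra
  only, since that is where \<open>Psi\<close> is known to be additive in \<open>a\<close> and
  \<open>b\<close>.\<close>

lemma extends_to_add:
  assumes "extends_to P S" "extends_to Q T"
    and "\<And>x. x \<in> group_alg \<Longrightarrow> R x = P x + Q x"
  shows "extends_to R (S + T)"
  using assms by (simp add: extends_to_def plus_blinfun.rep_eq)

lemma extends_to_scale:
  assumes "extends_to P T" and "\<And>x. x \<in> group_alg \<Longrightarrow> R x = c \<cdot>\<^sub>C P x"
  shows "extends_to R (c \<cdot>\<^sub>C T)"
  using assms by (simp add: extends_to_def op_scale_apply)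

text \<open>The induction on \<open>b\<close> runs inside the generator case for \<open>a\<close>;
  the remaining cases for \<open>a\<close> then keep the arbitrary \<open>b\<close> fixed.\<close>

lemma finite_rank_extension:
  assumes lreg: "\<And>u v. \<exists>T. finite_rank_op T \<and> compact_op T \<and> extends_to (Psi \<psi> (lreg u) (lreg v)) T"
    and a: "a \<in> group_alg" and b: "b \<in> group_alg"
  shows "\<exists>T. finite_rank_op T \<and> compact_op T \<and> extends_to (Psi \<psi> a b) T"
  using a
proof (induction rule: group_alg_induct)
  case (lreg u)
  show ?case
    using b
  proof (induction rule: group_alg_induct)
    case (lreg v)
    show ?case by (rule assms(1))
  next
    case (add b b')
    then show ?case
      by (meson finite_rank_op_add compact_op_add extends_to_add Psi_add_middle lreg_in_group_alg)
  next
    case (scale c b)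
    then show ?case
      by (meson finite_rank_op_scale compact_op_scale extends_to_scale Psi_scale_middle
          lreg_in_group_alg)
  qed
next
  case (add a a')
  then show ?case
    using b by (meson finite_rank_op_add compact_op_add extends_to_add Psi_add_left)
next
  case (scale c a)
  then show ?case
    using b by (meson finite_rank_op_scale compact_op_scale extends_to_scale Psi_scale_left)
qed

theorem lemma4p11:
  fixes \<psi> :: "'g::group_add \<Rightarrow> int"
    and \<Phi> :: "real \<Rightarrow> 'g op \<Rightarrow> 'g op"
  assumes "proper_fun \<psi>"
    and "symmetric_fun \<psi>"
    and "cond_neg_type (\<lambda>g. real_of_int (\<psi> g))"
    and "associated_semigroup (\<lambda>g. real_of_int (\<psi> g)) \<Phi>"
    and "\<exists>p. 1 \<le> p \<and> gradient_schatten p \<Phi>"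
  shows "(\<forall>u v. finite {g. gamma_fun \<psi> u v g \<noteq> 0}) \<and>
    (\<forall>u v. \<exists>T. finite_rank_op T \<and>
       extends_to (Psi (\<lambda>g. real_of_int (\<psi> g)) (lreg u) (lreg v)) T) \<and>
    (\<forall>p. 1 \<le> p \<longrightarrow> gradient_schatten p \<Phi>)"
proof -
  let ?\<psi> = "\<lambda>g. real_of_int (\<psi> g)"
  \<comment> \<open>The extension has real weights; this identifies them as integers, as the
    separation argument requires.\<close>
  have gamma: "gamma_fun ?\<psi> u v g = real_of_int (gamma_fun \<psi> u v g)" for u v g
    by (simp add: gamma_fun_def)
  have fin: "finite {g. gamma_fun \<psi> u v g \<noteq> 0}" for u v
  proof -
    from assms(5) obtain p \<phi> where "associated_semigroup \<phi> \<Phi>"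
      and ex: "\<forall>a\<in>group_alg. \<forall>b\<in>group_alg. \<exists>T. schatten p T \<and> extends_to (Psi \<phi> a b) T"
      unfolding gradient_schatten_def by blast
    \<comment> \<open>The gradient condition hides its function behind an existential; the
      semi-group determines it.\<close>
    then have "\<phi> = ?\<psi>"
      using assms(4) associated_semigroup_unique by blast
    then obtain T where T: "schatten p T" "extends_to (Psi ?\<psi> (lreg u) (lreg v)) T"
      using ex lreg_in_group_alg by blast
    have "inj (\<lambda>g. u + g + v)"
      by (rule injI) simp
    \<comment> \<open>Membership in the Schatten class includes compactness for every
      \<open>p\<close>, also for finite ones.\<close>
    with T show ?thesis
      using compact_op_finite_weights[of T "gamma_fun \<psi> u v" "\<lambda>g. u + g + v"]
        extends_to_Psi_delta[OF T(2)]
      by (simp add: schatten_def gamma)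
  qed
  have lreg: "\<exists>T. finite_rank_op T \<and> compact_op T \<and> extends_to (Psi ?\<psi> (lreg u) (lreg v)) T" for u v
    using fin by (intro finite_rank_extension_lreg) (simp add: gamma)
  \<comment> \<open>One finite rank extension for each pair \<open>a\<close>, \<open>b\<close>
    serves all exponents simultaneously.\<close>
  have "gradient_schatten p \<Phi>" for p
    unfolding gradient_schatten_def
    using assms(4) finite_rank_extension[OF lreg] finite_rank_compact_imp_schatten by meson
  with fin lreg show ?thesis by blast
qed

end
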